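(* Let $E$ be a finite set and let $\mathcal{M}_i=(E,\mathcal{F}_i)$, $i=1,\dots,m$, be matroids on $E$, with $r_i$ the rank function of $\mathcal{M}_i$. Then $$\max_{I\in\mathcal{B}(\bigcap_{i=1}^m\mathcal{M}_i)}|I|\ \leq\ \min\ \sum_{i=1}^m r_i(X_i),$$ where the minimum on the right-hand side is taken over all partitions $E=\bigsqcup_{i=1}^m X_i$ of $E$.
   Context: A matroid is a pair $(E,\mathcal{F})$ with $E$ finite and $\mathcal{F}\subseteq 2^E$ such that: (M1) $\emptyset\in\mathcal{F}$; (M2) if $X\subseteq Y\in\mathcal{F}$ then $X\in\mathcal{F}$; (M3) if $X,Y\in\mathcal{F}$ and $|X|>|Y|$ then there is $x\in X\setminus Y$ with $Y\cup\{x\}\in\mathcal{F}$. An independent system is a pair satisfying (M1) and (M2). The rank function is $r(X)=\max\{|Y|: Y\subseteq X,\ Y\in\mathcal{F}\}$. The intersection $\bigcap_{i=1}^m\mathcal{M}_i$ is the independent system $(E,\bigcap_{i=1}^m\mathcal{F}_i)$, and $\mathcal{B}(\mathcal{M})$ denotes the set of bases (inclusion-maximal members of the family) of an independent system $\mathcal{M}$. A partition $E=\bigsqcup_{i=1}^m X_i$ is a tuple $(X_1,\dots,X_m)$ of pairwise disjoint subsets of $E$ with union $E$. *)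

theory Defs
  imports Main "HOL-Library.FuncSet" "HOL-Library.Disjoint_Sets"
begin

definition independent_system :: "'a set \<Rightarrow> 'a set set \<Rightarrow> bool" where
  "independent_system E F \<longleftrightarrow>
     finite E \<and> F \<subseteq> Pow E \<and> {} \<in> F \<and> (\<forall>X Y. X \<subseteq> Y \<and> Y \<in> F \<longrightarrow> X \<in> F)"

definition matroid :: "'a set \<Rightarrow> 'a set set \<Rightarrow> bool" where
  "matroid E F \<longleftrightarrow> independent_system E F \<and>
     (\<forall>X\<in>F. \<forall>Y\<in>F. card Y < card X \<longrightarrow> (\<exists>x\<in>X - Y. Y \<union> {x} \<in> F))"

(* The maximum is over a finite nonempty set if F is an independent system on a finite ground set. *)
definition rank_of :: "'a set set \<Rightarrow> 'a set \<Rightarrow> nat" where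
  "rank_of F X = Max {card Y |Y. Y \<subseteq> X \<and> Y \<in> F}"

definition bases :: "'a set set \<Rightarrow> 'a set set" where
  "bases F = {B \<in> F. \<forall>B'\<in>F. B \<subseteq> B' \<longrightarrow> B' = B}"

(* An m-tuple (X 1, ..., X m) is an extensional function on {1..m}. Its entries may be empty. *)
definition partitions :: "'a set \<Rightarrow> nat \<Rightarrow> (nat \<Rightarrow> 'a set) set" where
  "partitions E m =
     {X \<in> {1..m} \<rightarrow>\<^sub>E Pow E. disjoint_family_on X {1..m} \<and> (\<Union>i\<in>{1..m}. X i) = E}"

end

(* Weak duality: an independent set I of the intersection splits as the disjoint union of the
   I \<inter> X i, and I \<inter> X i is an independent subset of X i in the i-th matroid, so it has at most
   rank_of (F i) (X i) elements. *)
theory Submission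
  imports Defs
begin

text \<open>Both axioms pass to intersections member by member. Over an empty index set the
  intersection would be \<open>UNIV\<close>, which need not lie within \<open>Pow E\<close>; hence
  \<open>A \<noteq> {}\<close>.\<close>

lemma independent_system_INTER:
  assumes "A \<noteq> {}" and "\<And>i. i \<in> A \<Longrightarrow> independent_system E (F i)"
  shows "independent_system E (\<Inter>i\<in>A. F i)"
  unfolding independent_system_def
proof (intro conjI allI impI)
  obtain i where i: "i \<in> A"
    using assms(1) by blast
  show "finite E"
    using assms(2)[OF i] by (simp add: independent_system_def)
  show "(\<Inter>i\<in>A. F i) \<subseteq> Pow E"
    using assms(2)[OF i] i by (auto simp: independent_system_def)
  show "{} \<in> (\<Inter>i\<in>A. F i)"
    using assms(2) by (simp add: independent_system_def)
  fix X Y assume "X \<subseteq> Y \<and> Y \<in> (\<Inter>i\<in>A. F i)"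
  then show "X \<in> (\<Inter>i\<in>A. F i)"
    using assms(2) by (simp add: independent_system_def) metis
qed

text \<open>A finite nonempty family has an inclusion-maximal member. This makes the maximum over
  bases in the theorem meaningful.\<close>

lemma bases_nonempty:
  assumes "independent_system E F"
  shows "bases F \<noteq> {}"
proof -
  have "finite F" "F \<noteq> {}"
    using assms by (auto simp: independent_system_def intro: finite_subset[of _ "Pow E"])
  then obtain B where "B \<in> F" "\<forall>B'\<in>F. B \<subseteq> B' \<longrightarrow> B = B'"
    using finite_has_maximal by metis
  then show ?thesis
    by (auto simp: bases_def)
qed

lemma card_le_rank_of:
  assumes "independent_system E F" "Y \<in> F" "Y \<subseteq> X"
  shows "card Y \<le> rank_of F X"
proof -
  have "finite F"
    using assms(1) by (auto simp: independent_system_def intro: finite_subset[of _ "Pow E"])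
  then have "finite {card Y |Y. Y \<subseteq> X \<and> Y \<in> F}"
    by simp
  then show ?thesis
    unfolding rank_of_def using assms(2,3) by (intro Max_ge) auto
qed

text \<open>Extensionality fixes the values outside \<open>{1..m}\<close>, so each tuple is
  represented by one function and all of them lie in a finite function space.\<close>

lemma finite_partitions: "finite E \<Longrightarrow> finite (partitions E m)"
  by (rule finite_subset[of _ "{1..m} \<rightarrow>\<^sub>E Pow E"]) (auto simp: partitions_def intro: finite_PiE)

lemma partitions_nonempty:
  assumes "1 \<le> m"
  shows "partitions E m \<noteq> {}"
proof -
  \<comment> \<open>The trivial partition: the first block is all of \<open>E\<close> and the others
    are empty. Index 1 is available because \<open>1 \<le> m\<close>.\<close>
  have "(\<lambda>i\<in>{1..m}. if i = 1 then E else {}) \<in> partitions E m"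
    using assms by (auto simp: partitions_def disjoint_family_on_def)
  then show ?thesis
    by blast
qed

lemma card_le_sum_rank_of:
  assumes "finite E"
    and sys: "\<And>i. i \<in> {1..m} \<Longrightarrow> independent_system E (F i)"
    and I: "I \<subseteq> E" "\<And>i. i \<in> {1..m} \<Longrightarrow> I \<in> F i"
    and X: "X \<in> partitions E m"
  shows "card I \<le> (\<Sum>i=1..m. rank_of (F i) (X i))"
proof -
  \<comment> \<open>The blocks cover \<open>E\<close>, hence their traces cover \<open>I\<close>;
    the union bound then suffices for the inequality.\<close>
  have "I = (\<Union>i\<in>{1..m}. I \<inter> X i)"
    using I(1) X by (auto simp: partitions_def)
  then have "card I = card (\<Union>i\<in>{1..m}. I \<inter> X i)"
    by (rule arg_cong)
  also have "\<dots> \<le> (\<Sum>i=1..m. card (I \<inter> X i))"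
    by (rule card_UN_le) simp
  also have "\<dots> \<le> (\<Sum>i=1..m. rank_of (F i) (X i))"
  proof (rule sum_mono)
    fix i assume i: "i \<in> {1..m}"
    \<comment> \<open>Downward closure (M2), applied to
      \<open>I \<inter> X i \<subseteq> I\<close>.\<close>
    then have "I \<inter> X i \<in> F i"
      using sys[OF i] I(2)[OF i] unfolding independent_system_def by (meson inf_le1)
    then show "card (I \<inter> X i) \<le> rank_of (F i) (X i)"
      using card_le_rank_of[OF sys[OF i]] by blast
  qed
  finally show ?thesis .
qed

theorem corollary1p1:
  fixes E :: "'a set" and F :: "nat \<Rightarrow> 'a set set" and m :: nat
  assumes "finite E"
    and "1 \<le> m"
    and "\<And>i. i \<in> {1..m} \<Longrightarrow> matroid E (F i)"
  shows "Max {card I |I. I \<in> bases (\<Inter>i\<in>{1..m}. F i)}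
           \<le> Min {\<Sum>i=1..m. rank_of (F i) (X i) |X. X \<in> partitions E m}"
proof -
  let ?G = "\<Inter>i\<in>{1..m}. F i"
  have sys: "independent_system E (F i)" if "i \<in> {1..m}" for i
    using assms(3)[OF that] by (simp add: matroid_def)
  have G: "independent_system E ?G"
    using assms(2) sys by (intro independent_system_INTER) auto
  have sub: "bases ?G \<subseteq> Pow E"
    using G by (auto simp: bases_def independent_system_def)
  have fin: "finite (bases ?G)"
    using sub assms(1) by (simp add: finite_subset)
  have le: "card I \<le> (\<Sum>i=1..m. rank_of (F i) (X i))"
    if "I \<in> bases ?G" "X \<in> partitions E m" for I X
  proof (rule card_le_sum_rank_of[OF assms(1) sys])
    show "I \<subseteq> E"
      using sub that(1) by blast
    show "I \<in> F i" if "i \<in> {1..m}" for i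
      using \<open>I \<in> bases ?G\<close> that unfolding bases_def by blast
  qed (use that in auto)
  \<comment> \<open>\<open>Min\<close> and \<open>Max\<close> are meaningful only on finite nonempty
    sets. Once this is checked for both sides, it remains to compare each base with each partition,
    which is \<open>le\<close>.\<close>
  show ?thesis
  proof (rule Min.boundedI)
    show "finite {\<Sum>i=1..m. rank_of (F i) (X i) |X. X \<in> partitions E m}"
      using finite_partitions[OF assms(1)] by simp
    show "{\<Sum>i=1..m. rank_of (F i) (X i) |X. X \<in> partitions E m} \<noteq> {}"
      using partitions_nonempty[OF assms(2)] by blast
    fix s assume s: "s \<in> {\<Sum>i=1..m. rank_of (F i) (X i) |X. X \<in> partitions E m}"
    show "Max {card I |I. I \<in> bases ?G} \<le> s"
    proof (rule Max.boundedI)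
      show "finite {card I |I. I \<in> bases ?G}"
        using fin by simp
      show "{card I |I. I \<in> bases ?G} \<noteq> {}"
        using bases_nonempty[OF G] by blast
      fix k assume "k \<in> {card I |I. I \<in> bases ?G}"
      then obtain I where "k = card I" "I \<in> bases ?G"
        by blast
      moreover obtain X where "s = (\<Sum>i=1..m. rank_of (F i) (X i))" "X \<in> partitions E m"
        using s by blast
      ultimately show "k \<le> s"
        using le by simp
    qed
  qed
qed

end
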